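(* Let $n\ge1$ and let $\lambda$ be a partition with at most $n$ parts. Then $$\bigl|\mathrm{SVT}_n(\lambda)\bigr|=\sum_A 2^{|\mathrm{Free}(A)|},$$ the sum being over all Gelfand–Zetlin patterns $A$ with top row $\lambda$; and for every $d\ge0$ the number of set-valued tableaux $T\in\mathrm{SVT}_n(\lambda)$ with $\mathrm{ex}(T)=d$ is $\sum_A\binom{|\mathrm{Free}(A)|}{d}$.
   Context: Let $\lambda=(\lambda_1\ge\dots\ge\lambda_n\ge0)$ and $[n]=\{1,\dots,n\}$. The Young diagram of $\lambda$ (English convention) has cells $(r,c)$, $1\le r\le n$, $1\le c\le\lambda_r$. A set-valued tableau of shape $\lambda$ is a filling $T$ of the cells by non-empty subsets of $[n]$ such that $\max T(r,c)\le\min T(r,c+1)$ and $\max T(r,c)<\min T(r+1,c)$ whenever both cells exist; $\mathrm{SVT}_n(\lambda)$ is the set of these, and $\mathrm{ex}(T)=\sum_{(r,c)}(|T(r,c)|-1)$. A Gelfand–Zetlin pattern $A$ with top row $\lambda$ is an array of integers $a_{ij}$ ($0\le i\le n-1$, $1\le j\le n-i$) with $a_{0,j}=\lambda_{n+1-j}$ and $a_{i-1,j}\le a_{ij}\le a_{i-1,j+1}$ for $i\ge1$. $\mathrm{Free}(A)$ is the set of positions $(i,j)$ with $i\ge1$ and $a_{ij}>a_{i-1,j}$. *)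

theory Defs
  imports Complex_Main "HOL-Library.FuncSet"
begin

text \<open>
  A partition with at most \<open>n\<close> parts is a function \<open>lam :: nat \<Rightarrow> nat\<close> that is weakly decreasing on
  \<open>{1..n}\<close>; its values outside \<open>{1..n}\<close> are never used. Fillings and arrays are extensional
  functions on their index set, so that each one is represented exactly once.
\<close>

definition young_diagram :: "nat \<Rightarrow> (nat \<Rightarrow> nat) \<Rightarrow> (nat \<times> nat) set" where
  "young_diagram n lam = {(r, c). r \<in> {1..n} \<and> c \<in> {1..lam r}}"

definition set_valued_tableaux :: "nat \<Rightarrow> (nat \<Rightarrow> nat) \<Rightarrow> (nat \<times> nat \<Rightarrow> nat set) set" where
  "set_valued_tableaux n lam =
    {T \<in> young_diagram n lam \<rightarrow>\<^sub>E (Pow {1..n} - {{}}).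
      (\<forall>r c. (r, c) \<in> young_diagram n lam \<and> (r, c + 1) \<in> young_diagram n lam
        \<longrightarrow> Max (T (r, c)) \<le> Min (T (r, c + 1))) \<and>
      (\<forall>r c. (r, c) \<in> young_diagram n lam \<and> (r + 1, c) \<in> young_diagram n lam
        \<longrightarrow> Max (T (r, c)) < Min (T (r + 1, c)))}"

definition excess :: "nat \<Rightarrow> (nat \<Rightarrow> nat) \<Rightarrow> (nat \<times> nat \<Rightarrow> nat set) \<Rightarrow> nat" where
  "excess n lam T = (\<Sum>x\<in>young_diagram n lam. card (T x) - 1)"

definition gz_positions :: "nat \<Rightarrow> (nat \<times> nat) set" where
  "gz_positions n = {(i, j). i \<in> {0..n - 1} \<and> j \<in> {1..n - i}}"

definition gz_patterns :: "nat \<Rightarrow> (nat \<Rightarrow> nat) \<Rightarrow> (nat \<times> nat \<Rightarrow> int) set" where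
  "gz_patterns n lam =
    {A \<in> gz_positions n \<rightarrow>\<^sub>E UNIV.
      (\<forall>j\<in>{1..n}. A (0, j) = int (lam (n + 1 - j))) \<and>
      (\<forall>(i, j)\<in>gz_positions n. i \<ge> 1 \<longrightarrow>
        A (i - 1, j) \<le> A (i, j) \<and> A (i, j) \<le> A (i - 1, j + 1))}"

definition free_positions :: "nat \<Rightarrow> (nat \<times> nat \<Rightarrow> int) \<Rightarrow> (nat \<times> nat) set" where
  "free_positions n A = {(i, j) \<in> gz_positions n. i \<ge> 1 \<and> A (i, j) > A (i - 1, j)}"

text \<open>All index sets are finite, so the cardinalities and sums over them are the intended ones.\<close>

lemma finite_young_diagram: "finite (young_diagram n lam)"
proof -
  have "young_diagram n lam = (SIGMA r:{1..n}. {1..lam r})"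
    by (auto simp: young_diagram_def)
  then show ?thesis by simp
qed

lemma finite_set_valued_tableaux: "finite (set_valued_tableaux n lam)"
  unfolding set_valued_tableaux_def
  by (rule finite_subset[OF Collect_restrict]) (intro finite_PiE finite_young_diagram, simp)

lemma finite_gz_positions: "finite (gz_positions n)"
  by (rule finite_subset[of _ "{0..n - 1} \<times> {1..n}"]) (auto simp: gz_positions_def)

lemma finite_free_positions: "finite (free_positions n A)"
  by (rule finite_subset[OF _ finite_gz_positions]) (auto simp: free_positions_def)

lemma finite_gz_patterns: "finite (gz_patterns n lam)"
proof -
  define M where "M = Max (lam ` {1..n})"
  have bound: "A (i, j) \<in> {0..int M}"
    if A: "A \<in> gz_patterns n lam" and "(i, j) \<in> gz_positions n" for A i j
    using that(2)
  proof (induction i arbitrary: j)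
    case 0
    then have j: "j \<in> {1..n}" by (auto simp: gz_positions_def)
    then have "lam (n + 1 - j) \<le> M"
      unfolding M_def by (intro Max_ge finite_imageI imageI) auto
    moreover have "A (0, j) = int (lam (n + 1 - j))"
      using A j unfolding gz_patterns_def by blast
    ultimately show ?case by simp
  next
    case (Suc i)
    then have "(i, j) \<in> gz_positions n" "(i, j + 1) \<in> gz_positions n"
      by (auto simp: gz_positions_def)
    with Suc.IH have "A (i, j) \<ge> 0" "A (i, j + 1) \<le> int M" by auto
    moreover have "A (i, j) \<le> A (Suc i, j)" "A (Suc i, j) \<le> A (i, j + 1)"
      using A Suc.prems unfolding gz_patterns_def by fastforce+
    ultimately show ?case by simp
  qed
  have "A \<in> gz_positions n \<rightarrow>\<^sub>E {0..int M}" if A: "A \<in> gz_patterns n lam" for A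
  proof (rule PiE_I)
    fix x assume "x \<in> gz_positions n"
    then show "A x \<in> {0..int M}" using bound[OF A] by (cases x) auto
  next
    fix x assume "x \<notin> gz_positions n"
    then show "A x = undefined" using A unfolding gz_patterns_def by (blast intro: PiE_arb)
  qed
  then have "gz_patterns n lam \<subseteq> gz_positions n \<rightarrow>\<^sub>E {0..int M}" by blast
  then show ?thesis
    by (rule finite_subset) (intro finite_PiE finite_gz_positions, simp)
qed

end

theory Submission
  imports Defs "HOL-Computational_Algebra.Polynomial"
begin

text \<open>
  Both counts follow from the identity
  \<open>(\<Sum>T. q ^ excess T) = (\<Sum>A. (1 + q) ^ card (Free A))\<close>, valid in every commutative semiring:
  \<open>q = 1\<close> gives the total, and comparing coefficients for an indeterminate \<open>q\<close> gives the count by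
  excess.

  The identity is proved by induction on \<open>n\<close>, deleting the largest entry \<open>Suc n\<close> from a tableau \<open>T\<close>
  of shape \<open>lam\<close>. The cells whose set is not just \<open>{Suc n}\<close> form the diagram of a partition \<open>mu\<close>
  with at most \<open>n\<close> parts. A cell containing \<open>Suc n\<close> has no cell of \<open>lam\<close> below it, which forces \<open>mu\<close>
  to interlace \<open>lam\<close>, that is \<open>lam (r + 1) \<le> mu r \<le> lam r\<close>. A cell that contains \<open>Suc n\<close>
  together with a smaller entry must be the last cell \<open>(r, mu r)\<close> of its row of \<open>mu\<close>, and again has
  nothing below it, so that \<open>lam (r + 1) < mu r\<close>. Conversely, for every interlacing \<open>mu\<close> the entry
  \<open>Suc n\<close> may be added to or omitted from the last cell of each such row independently. Hence \<open>T\<close>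
  amounts to a choice of \<open>mu\<close>, of a set of such rows, whose cardinality is the excess lost, and of
  a tableau of shape \<open>mu\<close> with entries up to \<open>n\<close> (\<open>add_largest_bij\<close>, \<open>excess_add_largest\<close>).

  On the other side, deleting the top row of a Gelfand--Zetlin pattern leaves a pattern whose top
  row is an arbitrary \<open>mu\<close> interlacing \<open>lam\<close>, and the free positions lost correspond to the rows
  with \<open>lam (r + 1) < mu r\<close> (\<open>add_top_row_bij\<close>, \<open>free_positions_add_top_row\<close>). Both sides therefore
  satisfy the same recursion, since the sum of \<open>q ^ card S\<close> over all subsets \<open>S\<close> of a \<open>k\<close>-element
  set is \<open>(1 + q) ^ k\<close>.
\<close>

section \<open>Interlacing partitions\<close>

definition interlacing :: "nat \<Rightarrow> (nat \<Rightarrow> nat) \<Rightarrow> (nat \<Rightarrow> nat) set" where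
  "interlacing n lam = {mu \<in> {1..n} \<rightarrow>\<^sub>E UNIV. \<forall>r\<in>{1..n}. lam (r + 1) \<le> mu r \<and> mu r \<le> lam r}"

definition free_rows :: "nat \<Rightarrow> (nat \<Rightarrow> nat) \<Rightarrow> (nat \<Rightarrow> nat) \<Rightarrow> nat set" where
  "free_rows n lam mu = {r \<in> {1..n}. lam (r + 1) < mu r}"

lemma finite_free_rows [simp]: "finite (free_rows n lam mu)"
  unfolding free_rows_def by simp

lemma finite_interlacing: "finite (interlacing n lam)"
proof (rule finite_subset)
  show "interlacing n lam \<subseteq> (\<Pi>\<^sub>E r\<in>{1..n}. {..lam r})"
    by (auto simp: interlacing_def PiE_def)
  show "finite (\<Pi>\<^sub>E r\<in>{1..n}. {..lam r})"
    by (intro finite_PiE) auto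
qed

lemma interlacingD:
  assumes "mu \<in> interlacing n lam" "1 \<le> r" "r \<le> n"
  shows "lam (r + 1) \<le> mu r" "mu r \<le> lam r"
  using assms by (auto simp: interlacing_def)

text \<open>
  Interlacing alone makes \<open>mu\<close> a partition, through \<open>mu (r + 1) \<le> lam (r + 1) \<le> mu r\<close>, so the
  induction may continue with \<open>mu\<close> in place of \<open>lam\<close>.
\<close>

lemma interlacing_antimono:
  assumes "mu \<in> interlacing n lam"
  shows "antimono_on {1..n} mu"
proof -
  have "r + k \<le> n \<Longrightarrow> mu (r + k) \<le> mu r" if "1 \<le> r" for r k
  proof (induction k)
    case (Suc k)
    from Suc.prems that have "mu (r + k + 1) \<le> lam (r + k + 1)" "lam (r + k + 1) \<le> mu (r + k)"
      using interlacingD[OF assms, of "r + k + 1"] interlacingD[OF assms, of "r + k"] by auto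
    with Suc show ?case by auto
  qed auto
  then show ?thesis
    by (intro monotone_onI) (metis atLeastAtMost_iff le_add_diff_inverse)
qed

text \<open>The expansion of a product of \<open>card A\<close> equal factors \<open>1 + q\<close> has one term for each subset.\<close>

lemma sum_power_card_Pow:
  fixes q :: "'a :: comm_semiring_1"
  assumes "finite A"
  shows "(\<Sum>S\<in>Pow A. q ^ card S) = (1 + q) ^ card A"
  using prod_add[OF assms, of "\<lambda>_. q" "\<lambda>_. 1"] by (simp add: add.commute)

section \<open>Set-valued tableaux\<close>

lemma mem_young_diagram:
  "(r, c) \<in> young_diagram n lam \<longleftrightarrow> 1 \<le> r \<and> r \<le> n \<and> 1 \<le> c \<and> c \<le> lam r"
  by (auto simp: young_diagram_def)

text \<open>Comparing entries instead of extrema makes the conditions stable under deleting entries.\<close>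

lemma set_valued_tableaux_iff:
  "T \<in> set_valued_tableaux n lam \<longleftrightarrow>
    T \<in> extensional (young_diagram n lam) \<and>
    (\<forall>x\<in>young_diagram n lam. T x \<noteq> {} \<and> T x \<subseteq> {1..n}) \<and>
    (\<forall>r c. (r, c) \<in> young_diagram n lam \<and> (r, c + 1) \<in> young_diagram n lam
        \<longrightarrow> (\<forall>a\<in>T (r, c). \<forall>b\<in>T (r, c + 1). a \<le> b)) \<and>
    (\<forall>r c. (r, c) \<in> young_diagram n lam \<and> (r + 1, c) \<in> young_diagram n lam
        \<longrightarrow> (\<forall>a\<in>T (r, c). \<forall>b\<in>T (r + 1, c). a < b))"
    (is "_ \<longleftrightarrow> ?E \<and> ?V \<and> ?R \<and> ?C")
proof -
  let ?D = "young_diagram n lam"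
  have fun_iff: "T \<in> ?D \<rightarrow>\<^sub>E (Pow {1..n} - {{}}) \<longleftrightarrow> ?E \<and> ?V"
    by (auto simp: PiE_iff)
  have le: "Max (T x) \<le> Min (T y) \<longleftrightarrow> (\<forall>a\<in>T x. \<forall>b\<in>T y. a \<le> b)"
    and less: "Max (T x) < Min (T y) \<longleftrightarrow> (\<forall>a\<in>T x. \<forall>b\<in>T y. a < b)"
    if V: ?V and "x \<in> ?D" "y \<in> ?D" for x y
  proof -
    have "T x \<noteq> {}" "T y \<noteq> {}" "finite (T x)" "finite (T y)"
      using that finite_subset[of _ "{1..n}"] by blast+
    then show "Max (T x) \<le> Min (T y) \<longleftrightarrow> (\<forall>a\<in>T x. \<forall>b\<in>T y. a \<le> b)"
      and "Max (T x) < Min (T y) \<longleftrightarrow> (\<forall>a\<in>T x. \<forall>b\<in>T y. a < b)"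
      by auto
  qed
  have R_iff: "(\<forall>r c. (r, c) \<in> ?D \<and> (r, c + 1) \<in> ?D \<longrightarrow> Max (T (r, c)) \<le> Min (T (r, c + 1))) \<longleftrightarrow> ?R"
    and C_iff: "(\<forall>r c. (r, c) \<in> ?D \<and> (r + 1, c) \<in> ?D \<longrightarrow> Max (T (r, c)) < Min (T (r + 1, c))) \<longleftrightarrow> ?C"
    if V: ?V
    by (intro all_cong1 imp_cong refl; elim conjE; erule (1) le[OF V] less[OF V])+
  show ?thesis
    unfolding set_valued_tableaux_def mem_Collect_eq fun_iff using R_iff C_iff by argo
qed

lemma set_valued_tableaux_0: "set_valued_tableaux 0 lam = {\<lambda>_. undefined}"
  by (auto simp: set_valued_tableaux_def young_diagram_def)

lemma tableau_value:
  assumes "T \<in> set_valued_tableaux n lam" "x \<in> young_diagram n lam"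
  shows "T x \<noteq> {}" "T x \<subseteq> {1..n}"
  using assms by (auto simp: set_valued_tableaux_iff)

lemma tableau_row_le:
  assumes T: "T \<in> set_valued_tableaux n lam"
    and "(r, c) \<in> young_diagram n lam" "(r, c') \<in> young_diagram n lam" "c < c'"
    and "a \<in> T (r, c)" "b \<in> T (r, c')"
  shows "a \<le> b"
proof -
  have "(r, c + 1 + k) \<in> young_diagram n lam \<Longrightarrow> b \<in> T (r, c + 1 + k) \<Longrightarrow> a \<le> b" for k b
  proof (induction k arbitrary: b)
    case 0
    then show ?case using T assms(2,5) by (auto simp: set_valued_tableaux_iff)
  next
    case (Suc k)
    then have D: "(r, c + 1 + k) \<in> young_diagram n lam"
      by (auto simp: mem_young_diagram)
    then obtain b' where b': "b' \<in> T (r, c + 1 + k)"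
      using tableau_value[OF T D] by blast
    have "b' \<le> b"
      using T D Suc.prems b' unfolding set_valued_tableaux_iff by simp
    with Suc.IH[OF D b'] show ?case by simp
  qed
  from this[of "c' - (c + 1)" b] assms show ?thesis by simp
qed

lemma tableau_column_less:
  assumes "T \<in> set_valued_tableaux n lam"
    and "(r, c) \<in> young_diagram n lam" "(r + 1, c) \<in> young_diagram n lam"
    and "a \<in> T (r, c)" "b \<in> T (r + 1, c)"
  shows "a < b"
  using assms unfolding set_valued_tableaux_iff by blast

text \<open>
  The \<open>r\<close> cells above and including \<open>(r, c)\<close> carry strictly increasing entries. Together with the
  bound on entries this forces the last row to consist of the largest entry alone.
\<close>

lemma tableau_row_index_le:
  assumes T: "T \<in> set_valued_tableaux n lam" and lam: "antimono_on {1..n} lam"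
  shows "(r, c) \<in> young_diagram n lam \<Longrightarrow> b \<in> T (r, c) \<Longrightarrow> r \<le> b"
proof (induction r arbitrary: b)
  case (Suc r)
  show ?case
  proof (cases "r = 0")
    case True
    then show ?thesis using tableau_value(2)[OF T Suc.prems(1)] Suc.prems(2) by auto
  next
    case False
    have D: "(r, c) \<in> young_diagram n lam"
      using Suc.prems(1) monotone_onD[OF lam, of r "Suc r"] False
      by (auto simp: mem_young_diagram)
    then obtain a where a: "a \<in> T (r, c)"
      using tableau_value(1)[OF T D] by blast
    have "a < b"
      using tableau_column_less[OF T D _ a] Suc.prems by simp
    with Suc.IH[OF D a] show ?thesis by simp
  qed
qed simp

section \<open>Adding the largest entry to a tableau\<close>

text \<open>
  The tableau of shape \<open>lam\<close> encoded by an inner shape \<open>mu\<close>, a tableau \<open>T\<close> on it, and the set \<open>S\<close> of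
  rows in which \<open>Suc n\<close> shares the last inner cell with smaller entries.
\<close>

definition add_largest ::
  "nat \<Rightarrow> (nat \<Rightarrow> nat) \<Rightarrow> (nat \<Rightarrow> nat) \<times> nat set \<times> (nat \<times> nat \<Rightarrow> nat set) \<Rightarrow> nat \<times> nat \<Rightarrow> nat set"
  where
  "add_largest n lam = (\<lambda>(mu, S, T). restrict (\<lambda>(r, c).
     if (r, c) \<in> young_diagram n mu
     then T (r, c) \<union> (if r \<in> S \<and> c = mu r then {Suc n} else {})
     else {Suc n}) (young_diagram (Suc n) lam))"

lemma young_diagram_interlacing:
  assumes "mu \<in> interlacing n lam"
  shows "young_diagram n mu \<subseteq> young_diagram (Suc n) lam"
  using interlacingD(2)[OF assms] by (force simp: mem_young_diagram)

lemma add_largest_inside: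
  assumes "mu \<in> interlacing n lam" "(r, c) \<in> young_diagram n mu"
  shows "add_largest n lam (mu, S, T) (r, c) =
    T (r, c) \<union> (if r \<in> S \<and> c = mu r then {Suc n} else {})"
  using assms young_diagram_interlacing[OF assms(1)] by (auto simp: add_largest_def)

lemma add_largest_outside:
  assumes "(r, c) \<in> young_diagram (Suc n) lam" "(r, c) \<notin> young_diagram n mu"
  shows "add_largest n lam (mu, S, T) (r, c) = {Suc n}"
  using assms by (auto simp: add_largest_def)

text \<open>
  New violations could only come from a cell with \<open>Suc n\<close> that has a neighbour to the right or
  below. To the right of such a cell there are only cells \<open>{Suc n}\<close>, which is harmless as rows
  are weakly increasing. Below it there is none: interlacing excludes this for the outer cells, and
  \<open>S \<subseteq> free_rows n lam mu\<close> for the last inner cells.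
\<close>

lemma add_largest_tableau:
  assumes mu: "mu \<in> interlacing n lam" and S: "S \<subseteq> free_rows n lam mu"
    and T: "T \<in> set_valued_tableaux n mu"
  shows "add_largest n lam (mu, S, T) \<in> set_valued_tableaux (Suc n) lam"
proof -
  let ?U = "add_largest n lam (mu, S, T)"
  let ?D = "young_diagram (Suc n) lam" and ?D' = "young_diagram n mu"
  note inside = add_largest_inside[OF mu] and outside = add_largest_outside
  have entries: "?U x \<noteq> {} \<and> ?U x \<subseteq> {1..Suc n}" if "x \<in> ?D" for x
  proof (cases x)
    case (Pair r c)
    show ?thesis
    proof (cases "(r, c) \<in> ?D'")
      case True
      then show ?thesis using tableau_value[OF T True] by (auto simp: Pair inside)
    next
      case False
      then show ?thesis using that by (auto simp: Pair outside)
    qed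
  qed
  have row: "a \<le> b" if "(r, c) \<in> ?D" "(r, c + 1) \<in> ?D" "a \<in> ?U (r, c)" "b \<in> ?U (r, c + 1)" for r c a b
  proof (cases "(r, c + 1) \<in> ?D'")
    case True
    then have D: "(r, c) \<in> ?D'" and c: "c < mu r"
      using that(1) by (auto simp: mem_young_diagram)
    have a: "a \<in> T (r, c)" using that(3) c by (simp add: inside[OF D])
    have "b \<in> T (r, c + 1) \<or> b = Suc n"
      using that(4) unfolding inside[OF True] by (auto split: if_splits)
    then show ?thesis
      using tableau_row_le[OF T D True _ a] tableau_value(2)[OF T D] a by auto
  next
    case False
    then have "b = Suc n" using that by (simp add: outside)
    then show ?thesis using entries[OF that(1)] that(3) by auto
  qed
  have column: "a < b" if "(r, c) \<in> ?D" "(r + 1, c) \<in> ?D" "a \<in> ?U (r, c)" "b \<in> ?U (r + 1, c)" for r c a b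
  proof -
    have c: "1 \<le> r" "r \<le> n" "1 \<le> c" "c \<le> lam (r + 1)" using that by (auto simp: mem_young_diagram)
    then have D: "(r, c) \<in> ?D'"
      using interlacingD(1)[OF mu, of r] by (auto simp: mem_young_diagram)
    have "\<not> (r \<in> S \<and> c = mu r)" using S c by (auto simp: free_rows_def)
    then have a: "a \<in> T (r, c)" using that(3) unfolding inside[OF D] by (auto split: if_splits)
    show ?thesis
    proof (cases "(r + 1, c) \<in> ?D'")
      case True
      have "b \<in> T (r + 1, c) \<or> b = Suc n"
        using that(4) unfolding inside[OF True] by (auto split: if_splits)
      then show ?thesis
        using tableau_column_less[OF T D True a] tableau_value(2)[OF T D] a by auto
    next
      case False
      then have "b = Suc n" using that by (simp add: outside)
      then show ?thesis using tableau_value(2)[OF T D] a by auto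
    qed
  qed
  have "?U \<in> extensional ?D" by (simp add: add_largest_def)
  with entries row column show ?thesis unfolding set_valued_tableaux_iff by blast
qed

text \<open>The inner shape can be read off from the filling, which is the key to injectivity.\<close>

lemma add_largest_nontrivial_cells:
  assumes mu: "mu \<in> interlacing n lam" and T: "T \<in> set_valued_tableaux n mu"
  shows "{x \<in> young_diagram (Suc n) lam. add_largest n lam (mu, S, T) x \<noteq> {Suc n}} = young_diagram n mu"
proof -
  have "add_largest n lam (mu, S, T) x \<noteq> {Suc n}" if x: "x \<in> young_diagram n mu" for x
  proof -
    obtain b where "b \<in> T x" "b \<noteq> Suc n" using tableau_value[OF T x] by fastforce
    then show ?thesis using x by (cases x) (auto simp: add_largest_inside[OF mu])
  qed
  moreover have "add_largest n lam (mu, S, T) x = {Suc n}"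
    if "x \<in> young_diagram (Suc n) lam" "x \<notin> young_diagram n mu" for x
    using that by (cases x) (simp add: add_largest_outside)
  ultimately show ?thesis using young_diagram_interlacing[OF mu] by blast
qed

lemma young_diagram_inject:
  assumes "young_diagram n mu = young_diagram n nu"
    and "mu \<in> extensional {1..n}" "nu \<in> extensional {1..n}"
  shows "mu = nu"
proof (rule extensionalityI[OF assms(2,3)])
  fix r assume r: "r \<in> {1..n}"
  have "(r, mu r) \<in> young_diagram n mu \<longleftrightarrow> (r, mu r) \<in> young_diagram n nu"
    "(r, nu r) \<in> young_diagram n mu \<longleftrightarrow> (r, nu r) \<in> young_diagram n nu"
    using assms(1) by auto
  with r show "mu r = nu r" by (auto simp: mem_young_diagram)
qed

lemma add_largest_inj:
  "inj_on (add_largest n lam)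
     (SIGMA mu:interlacing n lam. Pow (free_rows n lam mu) \<times> set_valued_tableaux n mu)"
proof (rule inj_onI, clarsimp)
  fix mu S T nu S' T'
  assume mu: "mu \<in> interlacing n lam" and S: "S \<subseteq> free_rows n lam mu"
    and T: "T \<in> set_valued_tableaux n mu"
    and nu: "nu \<in> interlacing n lam" and S': "S' \<subseteq> free_rows n lam nu"
    and T': "T' \<in> set_valued_tableaux n nu"
    and eq: "add_largest n lam (mu, S, T) = add_largest n lam (nu, S', T')"
  have "young_diagram n mu = young_diagram n nu"
    using add_largest_nontrivial_cells[OF mu T, of S] add_largest_nontrivial_cells[OF nu T', of S'] eq
    by simp
  then have [simp]: "nu = mu"
    using young_diagram_inject mu nu by (auto simp: interlacing_def PiE_iff)
  have S_iff: "r \<in> S \<longleftrightarrow> r \<in> {1..n} \<and> lam (r + 1) < mu r \<and> Suc n \<in> add_largest n lam (mu, S, T) (r, mu r)"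
    if S: "S \<subseteq> free_rows n lam mu" and T: "T \<in> set_valued_tableaux n mu" for r S T
  proof (cases "r \<in> {1..n} \<and> lam (r + 1) < mu r")
    case True
    then have D: "(r, mu r) \<in> young_diagram n mu" by (auto simp: mem_young_diagram)
    then show ?thesis using True tableau_value(2)[OF T D] by (auto simp: add_largest_inside[OF mu])
  next
    case False
    then show ?thesis using S by (auto simp: free_rows_def)
  qed
  have "S = S'"
    using S_iff[OF S T] S_iff[of S' T'] S' T' eq by auto
  moreover have "T = T'"
  proof (rule extensionalityI[of _ "young_diagram n mu"])
    have T_eq: "T x = add_largest n lam (mu, S, T) x - {Suc n}"
      if x: "x \<in> young_diagram n mu" and T: "T \<in> set_valued_tableaux n mu" for x S T
      using tableau_value(2)[OF T x] x by (cases x) (auto simp: add_largest_inside[OF mu])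
    show "T x = T' x" if "x \<in> young_diagram n mu" for x
      using T_eq[OF that T, of S] T_eq[OF that, of T' S'] T' eq by simp
  qed (use T T' in \<open>auto simp: set_valued_tableaux_iff\<close>)
  ultimately show "mu = nu \<and> S = S' \<and> T = T'" by simp
qed

text \<open>
  In each row the cells other than \<open>{Suc n}\<close> form an initial segment, because a cell containing
  \<open>Suc n\<close> forces \<open>{Suc n}\<close> everywhere to its right; the lengths of these segments give \<open>mu\<close>. The
  rows of \<open>S\<close> are those whose last inner cell contains \<open>Suc n\<close>. Interlacing and the freeness of
  those rows both express that nothing lies below a cell containing \<open>Suc n\<close>.
\<close>

lemma add_largest_surj:
  assumes lam: "antimono_on {1..Suc n} lam" and T: "T \<in> set_valued_tableaux (Suc n) lam"
  obtains mu S T' where "mu \<in> interlacing n lam" "S \<subseteq> free_rows n lam mu"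
    "T' \<in> set_valued_tableaux n mu" "T = add_largest n lam (mu, S, T')"
proof -
  let ?D = "young_diagram (Suc n) lam"
  have forced_right: "T (r, c') = {Suc n}"
    if "(r, c) \<in> ?D" "(r, c') \<in> ?D" "c < c'" "Suc n \<in> T (r, c)" for r c c'
    using tableau_row_le[OF T that] tableau_value[OF T that(2)] by fastforce
  have bottom: "(r + 1, c) \<notin> ?D" if "(r, c) \<in> ?D" "Suc n \<in> T (r, c)" for r c
    using tableau_column_less[OF T that(1) _ that(2)] tableau_value[OF T, of "(r + 1, c)"]
    by fastforce
  have last_row: "T (Suc n, c) = {Suc n}" if "(Suc n, c) \<in> ?D" for c
    using tableau_row_index_le[OF T lam that] tableau_value[OF T that] by fastforce
  define K where "K r = {c \<in> {1..lam r}. T (r, c) \<noteq> {Suc n}}" for r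
  \<comment> \<open>Inserting 0 makes the row length of an emptied row come out as 0.\<close>
  define mu where "mu = (\<lambda>r\<in>{1..n}. Max (insert 0 (K r)))"
  have K: "c \<in> K r \<longleftrightarrow> 1 \<le> c \<and> c \<le> mu r" if r: "r \<in> {1..n}" for r c
  proof -
    have mu_r: "mu r = Max (insert 0 (K r))" and fin: "finite (insert 0 (K r))"
      using r by (auto simp: mu_def K_def)
    show ?thesis
    proof (intro iffI conjI)
      assume "c \<in> K r"
      then show "1 \<le> c" "c \<le> mu r" using fin by (auto simp: mu_r K_def)
    next
      assume c: "1 \<le> c \<and> c \<le> mu r"
      then have "mu r \<in> K r" using Max_in[OF fin] unfolding mu_r[symmetric] by auto
      then show "c \<in> K r"
        using c r forced_right[of r c "mu r"]
        by (cases "c = mu r") (auto simp: K_def mem_young_diagram)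
    qed
  qed
  have in_D': "(r, c) \<in> young_diagram n mu \<longleftrightarrow> r \<le> n \<and> (r, c) \<in> ?D \<and> T (r, c) \<noteq> {Suc n}" for r c
    using K[of r c] by (auto simp: mem_young_diagram K_def)
  have mu_le: "mu r \<le> lam r" if "r \<in> {1..n}" for r
  proof (cases "mu r = 0")
    case False
    then have "mu r \<in> K r" using K[OF that] by simp
    then show ?thesis by (simp add: K_def)
  qed simp
  have le_mu: "lam (r + 1) \<le> mu r" if r: "r \<in> {1..n}" for r
  proof (cases "lam (r + 1) = 0")
    case False
    have "lam (r + 1) \<le> lam r" using r monotone_onD[OF lam, of r "r + 1"] by auto
    with False r have D: "(r, lam (r + 1)) \<in> ?D" "(r + 1, lam (r + 1)) \<in> ?D"
      by (auto simp: mem_young_diagram)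
    then have "Suc n \<notin> T (r, lam (r + 1))" using bottom by blast
    then have "lam (r + 1) \<in> K r" using D by (auto simp: K_def mem_young_diagram)
    then show ?thesis using K[OF r] by simp
  qed simp
  have mu: "mu \<in> interlacing n lam"
    using mu_le le_mu by (auto simp: interlacing_def mu_def)
  define S where "S = {r \<in> {1..n}. 1 \<le> mu r \<and> Suc n \<in> T (r, mu r)}"
  have S: "S \<subseteq> free_rows n lam mu"
  proof
    fix r assume r: "r \<in> S"
    then have "(r, mu r) \<in> ?D" "Suc n \<in> T (r, mu r)"
      using mu_le by (auto simp: S_def mem_young_diagram)
    then have "(r + 1, mu r) \<notin> ?D" by (rule bottom)
    then show "r \<in> free_rows n lam mu" using r by (auto simp: S_def free_rows_def mem_young_diagram)
  qed
  define T' where "T' = restrict (\<lambda>x. T x - {Suc n}) (young_diagram n mu)"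
  have "T' x \<noteq> {} \<and> T' x \<subseteq> {1..n}" if "x \<in> young_diagram n mu" for x
  proof -
    obtain r c where x: "x = (r, c)" by (cases x)
    have "x \<in> ?D" "T x \<noteq> {Suc n}" using that by (auto simp: in_D' x)
    then have "T x - {Suc n} \<noteq> {}" "T x - {Suc n} \<subseteq> {1..Suc n} - {Suc n}"
      using tableau_value[OF T, of x] by blast+
    moreover have "{1..Suc n} - {Suc n} = {1..n}" by auto
    ultimately show ?thesis using that by (simp add: T'_def)
  qed
  moreover have "a \<le> b" if "(r, c) \<in> young_diagram n mu" "(r, c + 1) \<in> young_diagram n mu"
    "a \<in> T' (r, c)" "b \<in> T' (r, c + 1)" for r c a b
    using tableau_row_le[OF T, of r c "c + 1" a b] that by (auto simp: T'_def in_D')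
  moreover have "a < b" if "(r, c) \<in> young_diagram n mu" "(r + 1, c) \<in> young_diagram n mu"
    "a \<in> T' (r, c)" "b \<in> T' (r + 1, c)" for r c a b
    using tableau_column_less[OF T, of r c a b] that by (auto simp: T'_def in_D')
  moreover have "T' \<in> extensional (young_diagram n mu)" by (simp add: T'_def)
  ultimately have T': "T' \<in> set_valued_tableaux n mu"
    unfolding set_valued_tableaux_iff by blast
  have "T = add_largest n lam (mu, S, T')"
  proof (rule extensionalityI[of _ ?D])
    fix x assume x: "x \<in> ?D"
    obtain r c where [simp]: "x = (r, c)" by (cases x)
    show "T x = add_largest n lam (mu, S, T') x"
    proof (cases "x \<in> young_diagram n mu")
      case True
      then have D: "(r, c) \<in> young_diagram n mu" by simp
      then have r: "r \<in> {1..n}" "1 \<le> c" "c \<le> mu r" by (auto simp: mem_young_diagram)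
      then have D2: "(r, mu r) \<in> young_diagram n mu" by (auto simp: mem_young_diagram)
      have "Suc n \<in> T (r, c) \<longleftrightarrow> r \<in> S \<and> c = mu r"
        using forced_right[of r c "mu r"] D D2 r by (fastforce simp: in_D' S_def)
      then show ?thesis using D by (auto simp: add_largest_inside[OF mu] T'_def)
    next
      case False
      have "T (r, c) = {Suc n}"
      proof (cases "r \<le> n")
        case True
        then show ?thesis using False x by (auto simp: in_D')
      next
        case False
        then have "r = Suc n" using x by (auto simp: mem_young_diagram)
        then show ?thesis using last_row x by auto
      qed
      then show ?thesis using False x by (simp add: add_largest_outside)
    qed
  qed (use T in \<open>auto simp: set_valued_tableaux_iff add_largest_def\<close>)
  with mu S T' show thesis by (rule that)
qed

lemma add_largest_bij:
  assumes "antimono_on {1..Suc n} lam"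
  shows "bij_betw (add_largest n lam)
    (SIGMA mu:interlacing n lam. Pow (free_rows n lam mu) \<times> set_valued_tableaux n mu)
    (set_valued_tableaux (Suc n) lam)"
  unfolding bij_betw_def
proof (intro conjI add_largest_inj equalityI subsetI)
  fix T assume T: "T \<in> set_valued_tableaux (Suc n) lam"
  obtain mu S T' where "mu \<in> interlacing n lam" "S \<subseteq> free_rows n lam mu"
    "T' \<in> set_valued_tableaux n mu" "T = add_largest n lam (mu, S, T')"
    using add_largest_surj[OF assms T] .
  then show "T \<in> add_largest n lam `
      (SIGMA mu:interlacing n lam. Pow (free_rows n lam mu) \<times> set_valued_tableaux n mu)"
    by (intro image_eqI[of _ _ "(mu, S, T')"]) auto
qed (auto intro: add_largest_tableau)

text \<open>
  Outer cells are singletons and contribute nothing; each row of \<open>S\<close> enlarges one non-empty inner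
  cell by one element.
\<close>

lemma excess_add_largest:
  assumes mu: "mu \<in> interlacing n lam" and S: "S \<subseteq> free_rows n lam mu"
    and T: "T \<in> set_valued_tableaux n mu"
  shows "excess (Suc n) lam (add_largest n lam (mu, S, T)) = excess n mu T + card S"
proof -
  let ?U = "add_largest n lam (mu, S, T)" and ?D' = "young_diagram n mu"
  let ?last = "(\<lambda>r. (r, mu r)) ` S"
  have last: "?last \<subseteq> ?D'" using S by (auto simp: free_rows_def mem_young_diagram)
  have "excess (Suc n) lam ?U = (\<Sum>x\<in>?D'. card (?U x) - 1)"
    unfolding excess_def
  proof (rule sum.mono_neutral_right)
    show "\<forall>x\<in>young_diagram (Suc n) lam - ?D'. card (?U x) - 1 = 0"
      by (auto simp: add_largest_outside)
  qed (use young_diagram_interlacing[OF mu] finite_young_diagram in auto)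
  also have "\<dots> = (\<Sum>x\<in>?D'. (card (T x) - 1) + (if x \<in> ?last then 1 else 0))"
  proof (rule sum.cong[OF refl])
    fix x assume x: "x \<in> ?D'"
    obtain r c where [simp]: "x = (r, c)" by (cases x)
    have fin: "finite (T x)" using tableau_value(2)[OF T x] by (auto intro: finite_subset)
    moreover have "card (T x) \<ge> 1"
      using fin tableau_value(1)[OF T x] by (simp add: Suc_le_eq card_gt_0_iff)
    moreover have "Suc n \<notin> T x" using tableau_value(2)[OF T x] by auto
    ultimately show "card (?U x) - 1 = (card (T x) - 1) + (if x \<in> ?last then 1 else 0)"
      using x by (auto simp: add_largest_inside[OF mu])
  qed
  also have "\<dots> = excess n mu T + card ?last"
    using last by (simp add: sum.distrib excess_def sum.If_cases finite_young_diagram Int_absorb1)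
  also have "card ?last = card S" by (intro card_image inj_onI) auto
  finally show ?thesis .
qed

section \<open>Removing the top row of a Gelfand--Zetlin pattern\<close>

lemma mem_gz_positions: "(i, j) \<in> gz_positions n \<longleftrightarrow> 1 \<le> j \<and> i + j \<le> n"
  by (auto simp: gz_positions_def)

lemma gz_patterns_iff:
  "A \<in> gz_patterns n lam \<longleftrightarrow> A \<in> extensional (gz_positions n) \<and>
    (\<forall>j. 1 \<le> j \<and> j \<le> n \<longrightarrow> A (0, j) = int (lam (n + 1 - j))) \<and>
    (\<forall>i j. 1 \<le> j \<and> Suc i + j \<le> n \<longrightarrow> A (i, j) \<le> A (Suc i, j) \<and> A (Suc i, j) \<le> A (i, j + 1))"
  (is "_ \<longleftrightarrow> _ \<and> _ \<and> ?R")
proof -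
  have "(\<forall>(i, j)\<in>gz_positions n. i \<ge> 1 \<longrightarrow> A (i - 1, j) \<le> A (i, j) \<and> A (i, j) \<le> A (i - 1, j + 1))
    \<longleftrightarrow> ?R" (is "?L \<longleftrightarrow> _")
  proof
    assume L: ?L
    show ?R
    proof (intro allI impI)
      fix i j assume "1 \<le> j \<and> Suc i + j \<le> n"
      then have "(Suc i, j) \<in> gz_positions n" by (simp add: mem_gz_positions)
      then show "A (i, j) \<le> A (Suc i, j) \<and> A (Suc i, j) \<le> A (i, j + 1)"
        using L[THEN bspec, of "(Suc i, j)"] by simp
    qed
  next
    assume R: ?R
    show ?L
    proof (clarify)
      fix i j assume "(i, j) \<in> gz_positions n" "1 \<le> i"
      then show "A (i - 1, j) \<le> A (i, j) \<and> A (i, j) \<le> A (i - 1, j + 1)"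
        using R[rule_format, of j "i - 1"] by (simp add: mem_gz_positions)
    qed
  qed
  then show ?thesis
    unfolding gz_patterns_def mem_Collect_eq by (auto simp: PiE_iff)
qed

lemma gz_pattern_top:
  assumes "A \<in> gz_patterns n lam" "1 \<le> j" "j \<le> n"
  shows "A (0, j) = int (lam (n + 1 - j))"
  using assms unfolding gz_patterns_iff by blast

lemma gz_pattern_bounds:
  assumes "A \<in> gz_patterns n lam" "1 \<le> j" "Suc i + j \<le> n"
  shows "A (i, j) \<le> A (Suc i, j)" "A (Suc i, j) \<le> A (i, j + 1)"
  using assms unfolding gz_patterns_iff by blast+

lemma gz_patterns_0: "gz_patterns 0 lam = {\<lambda>_. undefined}"
  by (auto simp: gz_patterns_def gz_positions_def)

text \<open>
  The pattern \<open>B\<close> determines \<open>mu\<close> as its top row; pairing the two makes the domain a disjoint union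
  over the interlacing partitions, parallel to that of \<open>add_largest\<close>. The row of index 1 of a pattern
  lists \<open>mu\<close> in reverse, so that position \<open>(1, j)\<close> belongs to row \<open>n + 1 - j\<close> of \<open>mu\<close>.
\<close>

definition add_top_row ::
  "nat \<Rightarrow> (nat \<Rightarrow> nat) \<Rightarrow> (nat \<Rightarrow> nat) \<times> (nat \<times> nat \<Rightarrow> int) \<Rightarrow> nat \<times> nat \<Rightarrow> int" where
  "add_top_row n lam = (\<lambda>(mu, B). restrict (\<lambda>(i, j).
     if i = 0 then int (lam (n + 2 - j)) else B (i - 1, j)) (gz_positions (Suc n)))"

definition second_row :: "nat \<Rightarrow> (nat \<times> nat \<Rightarrow> int) \<Rightarrow> nat \<Rightarrow> nat" where
  "second_row n A = (\<lambda>r\<in>{1..n}. nat (A (1, n + 1 - r)))"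

definition remove_top_row :: "nat \<Rightarrow> (nat \<times> nat \<Rightarrow> int) \<Rightarrow> nat \<times> nat \<Rightarrow> int" where
  "remove_top_row n A = restrict (\<lambda>(i, j). A (Suc i, j)) (gz_positions n)"

lemma add_top_row_0:
  "1 \<le> j \<Longrightarrow> j \<le> Suc n \<Longrightarrow> add_top_row n lam (mu, B) (0, j) = int (lam (n + 2 - j))"
  by (simp add: add_top_row_def mem_gz_positions)

lemma add_top_row_Suc:
  "1 \<le> j \<Longrightarrow> i + j \<le> n \<Longrightarrow> add_top_row n lam (mu, B) (Suc i, j) = B (i, j)"
  by (simp add: add_top_row_def mem_gz_positions)

lemma add_top_row_pattern:
  assumes mu: "mu \<in> interlacing n lam" and B: "B \<in> gz_patterns n mu"
  shows "add_top_row n lam (mu, B) \<in> gz_patterns (Suc n) lam"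
  unfolding gz_patterns_iff
proof (intro conjI allI impI)
  let ?A = "add_top_row n lam (mu, B)"
  show "?A \<in> extensional (gz_positions (Suc n))" by (simp add: add_top_row_def)
  show "?A (0, j) = int (lam (Suc n + 1 - j))" if "1 \<le> j \<and> j \<le> Suc n" for j
    using that by (simp add: add_top_row_0)
  fix i j assume ij: "1 \<le> j \<and> Suc i + j \<le> Suc n"
  have "?A (i, j) \<le> ?A (Suc i, j) \<and> ?A (Suc i, j) \<le> ?A (i, j + 1)"
  proof (cases i)
    case 0
    have r: "1 \<le> n + 1 - j" "n + 1 - j \<le> n" using ij by auto
    have "?A (1, j) = int (mu (n + 1 - j))"
      using gz_pattern_top[OF B, of j] add_top_row_Suc[of j 0 n lam mu B] ij by simp
    moreover have "?A (0, j) = int (lam (n + 1 - j + 1))"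
      using add_top_row_0[of j n lam mu B] ij by (simp add: Suc_diff_le)
    moreover have "?A (0, j + 1) = int (lam (n + 1 - j))"
      using add_top_row_0[of "j + 1" n lam mu B] ij by simp
    ultimately show ?thesis using interlacingD[OF mu r] 0 by simp
  next
    case (Suc k)
    have "B (k, j) \<le> B (Suc k, j) \<and> B (Suc k, j) \<le> B (k, j + 1)"
      using gz_pattern_bounds[OF B, of j k] ij Suc by simp
    then show ?thesis using ij Suc by (simp add: add_top_row_Suc)
  qed
  then show "?A (i, j) \<le> ?A (Suc i, j)" "?A (Suc i, j) \<le> ?A (i, j + 1)" by auto
qed

lemma
  assumes A: "A \<in> gz_patterns (Suc n) lam"
  shows second_row_interlacing: "second_row n A \<in> interlacing n lam"
    and remove_top_row_pattern: "remove_top_row n A \<in> gz_patterns n (second_row n A)"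
proof -
  have bounds: "int (lam (r + 1)) \<le> A (1, n + 1 - r) \<and> A (1, n + 1 - r) \<le> int (lam r)"
    if r: "1 \<le> r" "r \<le> n" for r
  proof -
    have "A (0, n + 1 - r) \<le> A (Suc 0, n + 1 - r) \<and> A (Suc 0, n + 1 - r) \<le> A (0, n + 1 - r + 1)"
      using gz_pattern_bounds[OF A, of "n + 1 - r" 0] r by simp
    moreover have "A (0, n + 1 - r) = int (lam (Suc n + 1 - (n + 1 - r)))"
      "A (0, n + 1 - r + 1) = int (lam (Suc n + 1 - (n + 1 - r + 1)))"
      by (rule gz_pattern_top[OF A]; use r in simp)+
    moreover have "Suc n + 1 - (n + 1 - r) = r + 1" "Suc n + 1 - (n + 1 - r + 1) = r"
      using r by auto
    ultimately show ?thesis unfolding One_nat_def by simp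
  qed
  have "lam (r + 1) \<le> nat (A (1, n + 1 - r)) \<and> nat (A (1, n + 1 - r)) \<le> lam r"
    if "1 \<le> r" "r \<le> n" for r
    using bounds[OF that] by linarith
  then show "second_row n A \<in> interlacing n lam"
    by (auto simp: interlacing_def second_row_def)
  have nonneg: "0 \<le> A (Suc 0, j)" if "1 \<le> j" "j \<le> n" for j
  proof -
    have "n + 1 - (n + 1 - j) = j" "1 \<le> n + 1 - j" "n + 1 - j \<le> n" using that by auto
    then show ?thesis using bounds[of "n + 1 - j"] by simp
  qed
  show "remove_top_row n A \<in> gz_patterns n (second_row n A)"
    using A nonneg unfolding gz_patterns_iff
    by (auto simp: remove_top_row_def second_row_def mem_gz_positions)
qed

text \<open>
  Position \<open>(1, j)\<close> compares \<open>mu (n + 1 - j)\<close> with \<open>lam (n + 2 - j)\<close>, so it is free exactly when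
  \<open>n + 1 - j\<close> is a free row. Positions further down only see entries of \<open>B\<close>.
\<close>

lemma free_positions_add_top_row:
  assumes mu: "mu \<in> interlacing n lam" and B: "B \<in> gz_patterns n mu"
  shows "card (free_positions (Suc n) (add_top_row n lam (mu, B))) =
    card (free_rows n lam mu) + card (free_positions n B)"
proof -
  let ?A = "add_top_row n lam (mu, B)"
  let ?f = "\<lambda>r. (1::nat, n + 1 - r)" and ?g = "\<lambda>(i, j). (Suc i, j::nat)"
  have top: "(1, j) \<in> free_positions (Suc n) ?A \<longleftrightarrow> 1 \<le> j \<and> j \<le> n \<and> n + 1 - j \<in> free_rows n lam mu"
    for j
  proof (cases "1 \<le> j \<and> j \<le> n")
    case True
    then have "B (0, j) = int (mu (n + 1 - j))" using gz_pattern_top[OF B] by blast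
    moreover have "n + 2 - j = n + 1 - j + 1" using True by auto
    moreover have "n + 1 - j \<in> {1..n}" using True by auto
    ultimately show ?thesis
      using True add_top_row_0[of j n lam mu B] add_top_row_Suc[of j 0 n lam mu B]
      by (simp add: free_positions_def free_rows_def mem_gz_positions)
  next
    case False
    then show ?thesis by (auto simp: free_positions_def mem_gz_positions)
  qed
  have below: "(Suc (Suc i), j) \<in> free_positions (Suc n) ?A \<longleftrightarrow> (Suc i, j) \<in> free_positions n B" for i j
    by (auto simp: free_positions_def mem_gz_positions add_top_row_Suc)
  have no_0: "(0, j) \<notin> free_positions m A" for j m A by (simp add: free_positions_def)
  have "free_positions (Suc n) ?A = ?f ` free_rows n lam mu \<union> ?g ` free_positions n B" (is "_ = ?R")
  proof (rule set_eqI)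
    fix x :: "nat \<times> nat"
    obtain i j where x: "x = (i, j)" by (cases x)
    consider "i = 0" | "i = 1" | k where "i = Suc (Suc k)"
      by (metis One_nat_def not0_implies_Suc)
    then show "x \<in> free_positions (Suc n) ?A \<longleftrightarrow> x \<in> ?R"
    proof cases
      case 1
      then show ?thesis using no_0 by (auto simp: x)
    next
      case 2
      have "1 \<le> j \<and> j \<le> n \<and> n + 1 - j \<in> free_rows n lam mu \<longleftrightarrow> x \<in> ?f ` free_rows n lam mu"
      proof
        assume j: "1 \<le> j \<and> j \<le> n \<and> n + 1 - j \<in> free_rows n lam mu"
        then show "x \<in> ?f ` free_rows n lam mu"
          by (intro image_eqI[of _ _ "n + 1 - j"]) (auto simp: x 2)
      qed (auto simp: x free_rows_def)
      moreover have "x \<notin> ?g ` free_positions n B" using no_0 by (auto simp: x 2)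
      ultimately show ?thesis using top[of j] by (simp add: x 2)
    next
      case 3
      then show ?thesis using below[of k j] by (force simp: x)
    qed
  qed
  moreover have "card (?f ` free_rows n lam mu) = card (free_rows n lam mu)"
    by (intro card_image inj_onI) (auto simp: free_rows_def)
  moreover have "card (?g ` free_positions n B) = card (free_positions n B)"
    by (intro card_image inj_onI) auto
  moreover have "?f ` free_rows n lam mu \<inter> ?g ` free_positions n B = {}"
    using no_0 by auto
  ultimately show ?thesis by (simp add: card_Un_disjoint finite_free_positions)
qed

lemma add_top_row_bij:
  "bij_betw (add_top_row n lam) (SIGMA mu:interlacing n lam. gz_patterns n mu) (gz_patterns (Suc n) lam)"
proof (rule bij_betw_byWitness[where f' = "\<lambda>A. (second_row n A, remove_top_row n A)"])
  show "\<forall>p\<in>SIGMA mu:interlacing n lam. gz_patterns n mu.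
      (second_row n (add_top_row n lam p), remove_top_row n (add_top_row n lam p)) = p"
  proof clarify
    fix mu B assume mu: "mu \<in> interlacing n lam" and B: "B \<in> gz_patterns n mu"
    have "second_row n (add_top_row n lam (mu, B)) = mu"
    proof (rule extensionalityI[of _ "{1..n}"])
      fix r assume r: "r \<in> {1..n}"
      then have "B (0, n + 1 - r) = int (mu r)" using gz_pattern_top[OF B, of "n + 1 - r"] by auto
      then show "second_row n (add_top_row n lam (mu, B)) r = mu r"
        using r add_top_row_Suc[where j = "n + 1 - r" and i = 0] by (auto simp: second_row_def)
    qed (use mu in \<open>auto simp: second_row_def interlacing_def PiE_iff\<close>)
    moreover have "remove_top_row n (add_top_row n lam (mu, B)) = B"
      by (rule extensionalityI[of _ "gz_positions n"])
        (use B in \<open>auto simp: remove_top_row_def gz_patterns_iff mem_gz_positions add_top_row_Suc\<close>)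
    ultimately show "second_row n (add_top_row n lam (mu, B)) = mu \<and>
        remove_top_row n (add_top_row n lam (mu, B)) = B"
      by simp
  qed
  show "\<forall>A\<in>gz_patterns (Suc n) lam. add_top_row n lam (second_row n A, remove_top_row n A) = A"
  proof
    fix A assume A: "A \<in> gz_patterns (Suc n) lam"
    show "add_top_row n lam (second_row n A, remove_top_row n A) = A"
    proof (rule extensionalityI[of _ "gz_positions (Suc n)"])
      fix x assume x: "x \<in> gz_positions (Suc n)"
      obtain i j where ij: "x = (i, j)" by (cases x)
      show "add_top_row n lam (second_row n A, remove_top_row n A) x = A x"
        using A x by (cases i)
          (auto simp: ij gz_patterns_iff mem_gz_positions add_top_row_0 add_top_row_Suc remove_top_row_def)
    qed (use A in \<open>auto simp: add_top_row_def gz_patterns_iff\<close>)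
  qed
qed (auto intro: add_top_row_pattern second_row_interlacing remove_top_row_pattern)

section \<open>The generating function\<close>

text \<open>
  Stated for an arbitrary commutative semiring, so that \<open>q\<close> can be both a number and an indeterminate.
\<close>

theorem tableaux_generating_function:
  fixes q :: "'a :: comm_semiring_1"
  assumes "antimono_on {1..n} lam"
  shows "(\<Sum>T\<in>set_valued_tableaux n lam. q ^ excess n lam T) =
    (\<Sum>A\<in>gz_patterns n lam. (1 + q) ^ card (free_positions n A))"
  using assms
proof (induction n arbitrary: lam)
  case 0
  then show ?case
    by (simp add: set_valued_tableaux_0 gz_patterns_0 excess_def young_diagram_def
        free_positions_def gz_positions_def)
next
  case (Suc n)
  let ?I = "interlacing n lam" and ?F = "free_rows n lam"
  have "(\<Sum>T\<in>set_valued_tableaux (Suc n) lam. q ^ excess (Suc n) lam T) =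
    (\<Sum>p\<in>(SIGMA mu:?I. Pow (?F mu) \<times> set_valued_tableaux n mu).
       q ^ excess (Suc n) lam (add_largest n lam p))"
    by (rule sum.reindex_bij_betw[OF add_largest_bij[OF Suc.prems], symmetric])
  also have "\<dots> = (\<Sum>(mu, S, T)\<in>(SIGMA mu:?I. Pow (?F mu) \<times> set_valued_tableaux n mu).
       q ^ card S * q ^ excess n mu T)"
    by (rule sum.cong) (auto simp: excess_add_largest power_add mult.commute)
  also have "\<dots> = (\<Sum>mu\<in>?I. \<Sum>(S, T)\<in>Pow (?F mu) \<times> set_valued_tableaux n mu.
       q ^ card S * q ^ excess n mu T)"
    by (rule sum.Sigma[symmetric]) (auto simp: finite_interlacing finite_set_valued_tableaux)
  also have "\<dots> = (\<Sum>mu\<in>?I. (1 + q) ^ card (?F mu) *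
       (\<Sum>T\<in>set_valued_tableaux n mu. q ^ excess n mu T))"
    by (simp add: sum_power_card_Pow[symmetric] sum_product sum.cartesian_product)
  also have "\<dots> = (\<Sum>mu\<in>?I. (1 + q) ^ card (?F mu) *
       (\<Sum>B\<in>gz_patterns n mu. (1 + q) ^ card (free_positions n B)))"
    by (intro sum.cong refl) (simp add: Suc.IH[OF interlacing_antimono])
  also have "\<dots> = (\<Sum>(mu, B)\<in>(SIGMA mu:?I. gz_patterns n mu).
       (1 + q) ^ (card (?F mu) + card (free_positions n B)))"
    by (simp add: sum_distrib_left power_add sum.Sigma finite_interlacing finite_gz_patterns)
  also have "\<dots> = (\<Sum>p\<in>(SIGMA mu:?I. gz_patterns n mu).
       (1 + q) ^ card (free_positions (Suc n) (add_top_row n lam p)))"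
    by (rule sum.cong) (auto simp: free_positions_add_top_row)
  also have "\<dots> = (\<Sum>A\<in>gz_patterns (Suc n) lam. (1 + q) ^ card (free_positions (Suc n) A))"
    by (rule sum.reindex_bij_betw[OF add_top_row_bij])
  finally show ?case .
qed

lemma coeff_1_plus_X_power:
  "coeff ([:1, 1:] ^ k) d = (of_nat (k choose d) :: 'a :: comm_semiring_1)"
proof (cases "d \<le> k")
  case True
  then show ?thesis by (simp add: coeff_linear_poly_power)
next
  case False
  then have "degree ([:1, 1:] ^ k :: 'a poly) < d"
    using degree_power_le[of "[:1, 1:] :: 'a poly" k] by simp
  with False show ?thesis by (simp add: coeff_eq_0 binomial_eq_0)
qed

theorem corollary3:
  fixes n :: nat and lam :: "nat \<Rightarrow> nat"
  assumes "n \<ge> 1" and "antimono_on {1..n} lam"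
  shows "card (set_valued_tableaux n lam) =
           (\<Sum>A\<in>gz_patterns n lam. 2 ^ card (free_positions n A)) \<and>
         (\<forall>d. card {T \<in> set_valued_tableaux n lam. excess n lam T = d} =
           (\<Sum>A\<in>gz_patterns n lam. card (free_positions n A) choose d))"
proof (intro conjI allI)
  have "card (set_valued_tableaux n lam) = (\<Sum>T\<in>set_valued_tableaux n lam. 1 ^ excess n lam T)"
    by simp
  also have "\<dots> = (\<Sum>A\<in>gz_patterns n lam. (1 + 1) ^ card (free_positions n A))"
    by (rule tableaux_generating_function[OF assms(2)])
  finally show "card (set_valued_tableaux n lam) =
      (\<Sum>A\<in>gz_patterns n lam. 2 ^ card (free_positions n A))"
    by (simp add: numeral_2_eq_2)
next
  fix d
  let ?X = "monom 1 1 :: nat poly"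
  have X: "1 + ?X = [:1, 1:]" by (simp add: monom_altdef one_pCons)
  have "card {T \<in> set_valued_tableaux n lam. excess n lam T = d} =
      (\<Sum>T\<in>set_valued_tableaux n lam. coeff (?X ^ excess n lam T) d)"
    by (simp add: monom_power sum.If_cases finite_set_valued_tableaux Int_def)
  also have "\<dots> = coeff (\<Sum>T\<in>set_valued_tableaux n lam. ?X ^ excess n lam T) d"
    by (simp add: coeff_sum)
  also have "\<dots> = (\<Sum>A\<in>gz_patterns n lam. coeff ([:1, 1:] ^ card (free_positions n A)) d)"
    by (simp only: tableaux_generating_function[OF assms(2)] X coeff_sum)
  also have "\<dots> = (\<Sum>A\<in>gz_patterns n lam. card (free_positions n A) choose d)"
    by (simp only: coeff_1_plus_X_power of_nat_id)
  finally show "card {T \<in> set_valued_tableaux n lam. excess n lam T = d} =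
      (\<Sum>A\<in>gz_patterns n lam. card (free_positions n A) choose d)" .
qed

end
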